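(* Let $E\subset\mathbb{R}^d$ be a non-empty bounded Borel set. Then $$\overline{\dim}_{\rm C}E=\inf\Big\{s\ge0:\ \text{for all }\mu\in\mathcal{P}(E),\ \text{for all sufficiently large }R,\ \int_{|z|\le R}|\widehat{\mu}(z)|^2\,dz\ge R^{d-s}\Big\},$$ where "sufficiently large" may depend on $\mu$ (and $s$).
   Context: $B(x,r)$ is the closed Euclidean ball in $\mathbb{R}^d$ with centre $x$ and radius $r$. $\mathcal{P}(E)$ is the set of Borel probability measures on $\mathbb{R}^d$ supported by $E$, i.e. with $\mu(\mathbb{R}^d\setminus E)=0$. The Fourier transform of $\mu$ is $\widehat{\mu}(z)=\int e^{i x\cdot z}\,d\mu(x)$, $z\in\mathbb{R}^d$. The upper correlation dimension of a Borel probability measure is $\overline{\dim}_{\rm C}\mu=\limsup_{r\to0}\frac{\log\int\mu(B(x,r))\,d\mu(x)}{\log r}$, and that of a Borel set is $\overline{\dim}_{\rm C}E=\sup_{\mu\in\mathcal{P}(E)}\overline{\dim}_{\rm C}\mu$. *)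

theory Defs
  imports "HOL-Probability.Probability"
begin

(* To be used for Borel sets E only: emeasure is 0 on non-measurable sets. *)
definition borel_probs_on :: "'a::euclidean_space set \<Rightarrow> 'a measure set" where
  "borel_probs_on E = {\<mu>. prob_space \<mu> \<and> sets \<mu> = sets borel \<and> emeasure \<mu> (UNIV - E) = 0}"

definition fourier_transform :: "'a::euclidean_space measure \<Rightarrow> 'a \<Rightarrow> complex" where
  "fourier_transform \<mu> z = (LINT x|\<mu>. exp (\<i> * complex_of_real (x \<bullet> z)))"

(* The correlation integral of a Borel probability measure is positive for every r > 0 and
   at most 1, so that the quotient involves no junk values for 0 < r < 1. *)
definition upper_correlation_dim :: "'a::euclidean_space measure \<Rightarrow> ereal" where
  "upper_correlation_dim \<mu> =
     Limsup (at_right 0) (\<lambda>r::real. ereal (ln (LINT x|\<mu>. measure \<mu> (cball x r)) / ln r))"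

definition upper_correlation_dim_set :: "'a::euclidean_space set \<Rightarrow> ereal" where
  "upper_correlation_dim_set E = (SUP \<mu>\<in>borel_probs_on E. upper_correlation_dim \<mu>)"

end

theory Submission
  imports Defs "HOL-Real_Asymp.Real_Asymp"
begin

text \<open>
  The Fourier energy \<open>I(R) = \<integral>\<^bsub>|z| \<le> R\<^esub> |\<mu>^(z)|\<^sup>2 dz\<close> and the correlation integral
  \<open>C(r) = \<integral> \<mu>(B(x,r)) d\<mu>(x)\<close> both use a sharp cutoff, one in frequency and one in space.
  A Gaussian cutoff is a bridge between them, because its Fourier transform is again Gaussian:
  with \<open>J(R) = \<integral>\<integral> exp(-R\<^sup>2|x-y|\<^sup>2/2) d\<mu>(x) d\<mu>(y)\<close>, writing \<open>|\<mu>^(z)|\<^sup>2\<close> as the double integral of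
  \<open>cos((x-y)\<bullet>z)\<close> and exchanging integrals yields (\<open>gaussian_parseval\<close>)
  \<open>\<integral> exp(-|z|\<^sup>2/(2R\<^sup>2)) |\<mu>^(z)|\<^sup>2 dz = c R\<^sup>d J(R)\<close> with \<open>c = (2\<pi>)\<^bsup>d/2\<^esup>\<close>.

  The Gaussian dominates a multiple of the indicator of a ball, so \<open>C(1/R)\<close> is at most a constant
  times \<open>J(R)\<close>, and \<open>I(R)\<close> at most a constant times \<open>R\<^sup>d J(R)\<close>. Conversely, a Gaussian is at most
  the indicator of a ball enlarged by a factor \<open>t\<close>, plus a tail \<open>exp(-k t\<^sup>2)\<close>. With
  \<open>t = R\<^sup>\<delta>\<close> the tail is smaller than every power of \<open>R\<close> (\<open>gaussian_tail_negligible\<close>), while the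
  enlargement changes exponents only by an amount that vanishes with \<open>\<delta>\<close>.
  Hence, for each single measure and \<open>s \<ge> 0\<close>: if \<open>I(R) \<ge> R\<^bsup>d-s\<^esup>\<close> eventually, then the correlation
  dimension is at most \<open>s\<close>; and if the correlation dimension is below \<open>s\<close>, then
  \<open>I(R) \<ge> R\<^bsup>d-s\<^esup>\<close> eventually. Quantifying over the measures on \<open>E\<close> gives the two inequalities of
  the theorem; a point mass in \<open>E\<close> ensures that the supremum of the dimensions is nonnegative, as
  the condition \<open>s \<ge> 0\<close> in the infimum demands.
\<close>

section \<open>The Fourier transform of a Gaussian\<close>

text \<open>
  The substitution \<open>z = R u\<close> reduces the integral to the characteristic function of the standard
  normal distribution.
\<close>

lemma gaussian_fourier_real:
  fixes R w :: real
  assumes "R > 0"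
  shows "has_bochner_integral lborel (\<lambda>z::real. complex_of_real (exp (- z\<^sup>2 / (2 * R\<^sup>2))) * iexp (w * z))
           (complex_of_real (sqrt (2 * pi) * R * exp (- (R * w)\<^sup>2 / 2)))"
proof -
  let ?f = "\<lambda>z::real. complex_of_real (exp (- z\<^sup>2 / (2 * R\<^sup>2))) * iexp (w * z)"
  let ?g = "\<lambda>u::real. std_normal_density u *\<^sub>R iexp (R * w * u)"
  have eq: "?f (0 + R * u) = of_real (sqrt (2 * pi)) * ?g u" for u
    using assms by (simp add: std_normal_density_def field_simps power_mult_distrib scaleR_conv_of_real)
  have "integrable lborel ?g"
  proof (rule Bochner_Integration.integrable_bound)
    show "integrable lborel std_normal_density"
      by (rule integrable_normal_density) simp
  qed (simp_all add: normal_density_nonneg)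
  then have "integrable lborel (\<lambda>u. ?f (0 + R * u))"
    unfolding eq by (rule integrable_mult_right)
  then have "integrable lborel ?f"
    using lborel_integrable_real_affine_iff[of R ?f 0] assms by simp
  moreover have "integral\<^sup>L lborel ?f = of_real (sqrt (2 * pi) * R * exp (- (R * w)\<^sup>2 / 2))"
  proof -
    have "integral\<^sup>L lborel ?g = char std_normal_distribution (R * w)"
      unfolding char_def by (subst integral_density) (simp_all add: normal_density_nonneg)
    then have "integral\<^sup>L lborel ?g = of_real (exp (- (R * w)\<^sup>2 / 2))"
      by (simp add: char_std_normal_distribution)
    then have "integral\<^sup>L lborel (\<lambda>u. ?f (0 + R * u)) = of_real (sqrt (2 * pi)) * of_real (exp (- (R * w)\<^sup>2 / 2))"
      unfolding eq by (subst integral_mult_right_zero) simp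
    then show ?thesis
      using lborel_integral_real_affine[of R ?f 0] assms
      by (simp add: scaleR_conv_of_real mult_ac)
  qed
  ultimately show ?thesis by (simp add: has_bochner_integral_iff)
qed

text \<open>
  In an orthonormal basis both factors of the integrand split into products over the coordinates,
  so the integral is a product of one-dimensional ones.
\<close>

lemma gaussian_fourier:
  fixes w :: "'a::euclidean_space"
  assumes "R > 0"
  shows "has_bochner_integral lborel
           (\<lambda>z. complex_of_real (exp (- (norm z)\<^sup>2 / (2 * R\<^sup>2))) * iexp (w \<bullet> z))
           (complex_of_real ((sqrt (2 * pi) * R) ^ DIM('a) * exp (- (R * norm w)\<^sup>2 / 2)))"
proof -
  interpret product_sigma_finite "\<lambda>_::'a. lborel :: real measure" ..
  let ?h = "\<lambda>b t::real. complex_of_real (exp (- t\<^sup>2 / (2 * R\<^sup>2))) * iexp ((w \<bullet> b) * t)"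
  let ?F = "\<lambda>z. complex_of_real (exp (- (norm z)\<^sup>2 / (2 * R\<^sup>2))) * iexp (w \<bullet> z)"
  let ?T = "\<lambda>f::'a \<Rightarrow> real. \<Sum>b\<in>Basis. f b *\<^sub>R b"
  note h = gaussian_fourier_real[OF assms]
  have F: "?F (?T f) = (\<Prod>b\<in>Basis. ?h b (f b))" for f
  proof -
    have "(norm (?T f))\<^sup>2 = (\<Sum>b\<in>Basis. (f b)\<^sup>2)"
      unfolding power2_norm_eq_inner by (subst euclidean_inner) (simp add: power2_eq_square)
    moreover have "w \<bullet> ?T f = (\<Sum>b\<in>Basis. (w \<bullet> b) * f b)"
      by (simp add: inner_sum_right mult.commute)
    ultimately show ?thesis
      by (simp add: prod.distrib exp_sum[symmetric] sum_negf sum_divide_distrib sum_distrib_left)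
         (simp add: exp_sum[symmetric] of_real_prod[symmetric] sum_negf sum_divide_distrib sum_distrib_left del: of_real_prod)
  qed
  have norm_w: "(norm w)\<^sup>2 = (\<Sum>b\<in>Basis. (w \<bullet> b)\<^sup>2)"
    unfolding power2_norm_eq_inner by (subst euclidean_inner) (simp add: power2_eq_square)
  have T[measurable]: "?T \<in> (\<Pi>\<^sub>M b\<in>Basis. lborel) \<rightarrow>\<^sub>M borel" by measurable
  have Fm: "?F \<in> borel_measurable borel" by measurable
  have "integrable (\<Pi>\<^sub>M b\<in>Basis. lborel) (\<lambda>f. \<Prod>b\<in>Basis. ?h b (f b))"
    using h by (intro product_integrable_prod) (auto simp: has_bochner_integral_iff)
  then have "integrable lborel ?F"
    unfolding F[symmetric] by (subst lborel_eq) (rule integrable_distr_eq[OF T Fm, THEN iffD2])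
  have "integral\<^sup>L lborel ?F = (\<integral>f. (\<Prod>b\<in>Basis. ?h b (f b)) \<partial>(\<Pi>\<^sub>M b\<in>Basis. lborel))"
    unfolding F[symmetric] by (subst lborel_eq) (rule integral_distr[OF T Fm])
  also have "\<dots> = (\<Prod>b\<in>Basis. integral\<^sup>L lborel (?h b))"
    using h by (intro product_integral_prod) (auto simp: has_bochner_integral_iff)
  also have "\<dots> = (\<Prod>b\<in>(Basis::'a set). complex_of_real (sqrt (2 * pi) * R * exp (- (R * (w \<bullet> b))\<^sup>2 / 2)))"
    using h by (intro prod.cong) (auto simp: has_bochner_integral_iff)
  also have "\<dots> = of_real ((sqrt (2 * pi) * R) ^ DIM('a) * (\<Prod>b\<in>(Basis::'a set). exp (- (R * (w \<bullet> b))\<^sup>2 / 2)))"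
    by (simp only: of_real_prod[symmetric] prod.distrib prod_constant power_mult_distrib)
  also have "(\<Prod>b\<in>(Basis::'a set). exp (- (R * (w \<bullet> b))\<^sup>2 / 2)) = exp (- (R * norm w)\<^sup>2 / 2)"
    by (simp add: exp_sum[symmetric] power_mult_distrib norm_w sum_distrib_left sum_negf sum_divide_distrib)
  finally show ?thesis
    using \<open>integrable lborel ?F\<close> by (simp add: has_bochner_integral_iff)
qed

lemma gaussian_cos:
  fixes w :: "'a::euclidean_space"
  assumes "R > 0"
  shows "has_bochner_integral lborel (\<lambda>z. exp (- (norm z)\<^sup>2 / (2 * R\<^sup>2)) * cos (w \<bullet> z))
           ((sqrt (2 * pi) * R) ^ DIM('a) * exp (- (R * norm w)\<^sup>2 / 2))"
proof -
  have "Re (iexp t) = cos t" for t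
    by (simp add: cis_conv_exp[symmetric])
  then show ?thesis
    using has_bochner_integral_bounded_linear[OF bounded_linear_Re gaussian_fourier[OF assms, of w]]
    by simp
qed

corollary gaussian_integral:
  assumes "R > 0"
  shows "has_bochner_integral lborel (\<lambda>z::'a::euclidean_space. exp (- (norm z)\<^sup>2 / (2 * R\<^sup>2)))
           ((sqrt (2 * pi) * R) ^ DIM('a))"
  using gaussian_cos[OF assms, of "0::'a"] by simp

section \<open>Gaussian energy of a measure\<close>

definition fourier_energy :: "'a::euclidean_space measure \<Rightarrow> real \<Rightarrow> real" where
  "fourier_energy \<mu> R = (LINT z:cball 0 R|lborel. (cmod (fourier_transform \<mu> z))\<^sup>2)"

definition correlation_integral :: "'a::euclidean_space measure \<Rightarrow> real \<Rightarrow> real" where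
  "correlation_integral \<mu> r = (LINT x|\<mu>. measure \<mu> (cball x r))"

text \<open>
  The correlation integral with the indicator of \<open>dist x y \<le> 1 / R\<close> replaced by a Gaussian of the
  same width. Integrating over the product measure keeps all comparisons pointwise and leaves a
  single exchange of integrals in the Parseval identity.
\<close>

definition gaussian_energy :: "'a::euclidean_space measure \<Rightarrow> real \<Rightarrow> real" where
  "gaussian_energy \<mu> R = (LINT p|(\<mu> \<Otimes>\<^sub>M \<mu>). exp (- (R * dist (fst p) (snd p))\<^sup>2 / 2))"

locale borel_prob_space = prob_space \<mu> for \<mu> :: "'a::euclidean_space measure" +
  assumes sets_eq_borel[measurable_cong]: "sets \<mu> = sets borel"
begin

sublocale pair: pair_prob_space \<mu> \<mu> ..

lemma space_eq_UNIV [simp]: "space \<mu> = UNIV"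
  using sets_eq_imp_space_eq[OF sets_eq_borel] by simp

lemma space_pair_eq_UNIV [simp]: "space (\<mu> \<Otimes>\<^sub>M \<mu>) = UNIV"
  by (simp add: space_pair_measure)

lemma measurable_fourier_transform [measurable]: "fourier_transform \<mu> \<in> borel_measurable borel"
  unfolding fourier_transform_def[abs_def]
  by (rule borel_measurable_lebesgue_integral) measurable

lemma norm_fourier_transform_le_1: "cmod (fourier_transform \<mu> z) \<le> 1"
proof -
  have "cmod (fourier_transform \<mu> z) \<le> (LINT x|\<mu>. cmod (iexp (x \<bullet> z)))"
    unfolding fourier_transform_def by (rule integral_norm_bound)
  also have "\<dots> = 1" using prob_space by simp
  finally show ?thesis .
qed

lemma norm_fourier_transform_sq_le_1: "(cmod (fourier_transform \<mu> z))\<^sup>2 \<le> 1"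
  using power_mono[OF norm_fourier_transform_le_1, of z 2] by simp

text \<open>
  Squares of the real and the imaginary part are double integrals of
  \<open>cos (x \<bullet> z) * cos (y \<bullet> z)\<close> and \<open>sin (x \<bullet> z) * sin (y \<bullet> z)\<close>, which the addition theorem combines.
\<close>

lemma norm_fourier_transform_sq:
  "(cmod (fourier_transform \<mu> z))\<^sup>2 = (LINT p|(\<mu> \<Otimes>\<^sub>M \<mu>). cos ((fst p - snd p) \<bullet> z))"
proof -
  have int[simp]: "integrable \<mu> (\<lambda>x. iexp (x \<bullet> z))" "integrable \<mu> (\<lambda>x. cos (x \<bullet> z))" "integrable \<mu> (\<lambda>x. sin (x \<bullet> z))"
    by (rule integrable_const_bound[where B=1]; simp)+
  have "Re (fourier_transform \<mu> z) = (LINT x|\<mu>. cos (x \<bullet> z))" "Im (fourier_transform \<mu> z) = (LINT x|\<mu>. sin (x \<bullet> z))"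
    unfolding fourier_transform_def integral_Re[OF int(1), symmetric] integral_Im[OF int(1), symmetric]
    by (simp_all add: cis_conv_exp[symmetric])
  then have "(cmod (fourier_transform \<mu> z))\<^sup>2 =
      (LINT x|\<mu>. cos (x \<bullet> z)) * (LINT x|\<mu>. cos (x \<bullet> z)) + (LINT x|\<mu>. sin (x \<bullet> z)) * (LINT x|\<mu>. sin (x \<bullet> z))"
    unfolding cmod_power2 by (simp add: power2_eq_square)
  also have "\<dots> = (LINT x|\<mu>. LINT y|\<mu>. cos ((x - y) \<bullet> z))"
    by (simp add: inner_diff_left cos_diff)
  also have "\<dots> = (LINT p|(\<mu> \<Otimes>\<^sub>M \<mu>). cos ((fst p - snd p) \<bullet> z))"
    by (subst pair.integral_fst'[symmetric]) (simp_all add: pair.integrable_const_bound[where B=1])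
  finally show ?thesis .
qed

lemma integrable_gaussian_fourier_transform:
  assumes "R > 0"
  shows "integrable lborel (\<lambda>z. exp (- (norm z)\<^sup>2 / (2 * R\<^sup>2)) * (cmod (fourier_transform \<mu> z))\<^sup>2)"
proof (rule Bochner_Integration.integrable_bound)
  show "integrable lborel (\<lambda>z::'a. exp (- (norm z)\<^sup>2 / (2 * R\<^sup>2)))"
    using gaussian_integral[OF assms, where 'a='a] by (simp add: has_bochner_integral_iff)
qed (simp_all add: norm_fourier_transform_sq_le_1 mult_le_cancel_left1)

text \<open>
  Fubini applies because the integrand is dominated by the Gaussian in \<open>z\<close>, which is integrable
  against the product with a probability measure; the inner integral is then \<open>gaussian_cos\<close> at
  \<open>w = x - y\<close>.
\<close>

lemma gaussian_parseval:
  assumes "R > 0"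
  shows "(LINT z|lborel. exp (- (norm z)\<^sup>2 / (2 * R\<^sup>2)) * (cmod (fourier_transform \<mu> z))\<^sup>2) =
    (sqrt (2 * pi) * R) ^ DIM('a) * gaussian_energy \<mu> R"
proof -
  interpret L: pair_sigma_finite "lborel :: 'a measure" "\<mu> \<Otimes>\<^sub>M \<mu>" ..
  let ?f = "\<lambda>(z::'a) p. exp (- (norm z)\<^sup>2 / (2 * R\<^sup>2)) * cos ((fst p - snd p) \<bullet> z)"
  have g: "integrable lborel (\<lambda>z::'a. exp (- (norm z)\<^sup>2 / (2 * R\<^sup>2)))"
    using gaussian_integral[OF assms, where 'a='a] by (simp add: has_bochner_integral_iff)
  have int: "integrable (\<mu> \<Otimes>\<^sub>M \<mu>) (?f z)" for z
    by (rule pair.integrable_const_bound[where B="exp (- (norm z)\<^sup>2 / (2 * R\<^sup>2))"])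
       (simp_all add: abs_mult mult_le_cancel_left1)
  have "integrable (lborel \<Otimes>\<^sub>M (\<mu> \<Otimes>\<^sub>M \<mu>)) (\<lambda>(z, p). ?f z p)"
  proof (rule L.Fubini_integrable)
    show "integrable lborel (\<lambda>z. LINT p|(\<mu> \<Otimes>\<^sub>M \<mu>). norm (case (z, p) of (z, p) \<Rightarrow> ?f z p))"
    proof (rule Bochner_Integration.integrable_bound[OF g])
      show "AE z in lborel. norm (LINT p|(\<mu> \<Otimes>\<^sub>M \<mu>). norm (case (z, p) of (z, p) \<Rightarrow> ?f z p))
              \<le> norm (exp (- (norm z)\<^sup>2 / (2 * R\<^sup>2)))"
      proof (rule AE_I2)
        fix z :: 'a
        have "(LINT p|(\<mu> \<Otimes>\<^sub>M \<mu>). norm (?f z p)) \<le> exp (- (norm z)\<^sup>2 / (2 * R\<^sup>2))"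
          using int[of z] by (intro pair.integral_le_const) (auto simp: abs_mult mult_le_cancel_left1)
        then show "norm (LINT p|(\<mu> \<Otimes>\<^sub>M \<mu>). norm (case (z, p) of (z, p) \<Rightarrow> ?f z p))
              \<le> norm (exp (- (norm z)\<^sup>2 / (2 * R\<^sup>2)))" by simp
      qed
    qed measurable
  qed (use int in \<open>simp_all\<close>)
  from L.Fubini_integral[OF this]
  have "(LINT z|lborel. LINT p|(\<mu> \<Otimes>\<^sub>M \<mu>). ?f z p) = (LINT p|(\<mu> \<Otimes>\<^sub>M \<mu>). LINT z|lborel. ?f z p)" ..
  then show ?thesis
    using gaussian_cos[OF assms, where 'a='a, THEN has_bochner_integral_integral_eq]
    by (simp add: norm_fourier_transform_sq gaussian_energy_def dist_norm)
qed

lemma correlation_integral_eq_measure_pair: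
  "correlation_integral \<mu> r = measure (\<mu> \<Otimes>\<^sub>M \<mu>) {p. dist (fst p) (snd p) \<le> r}"
proof -
  let ?A = "{p. dist (fst p) (snd p) \<le> r} :: ('a \<times> 'a) set"
  have A[measurable]: "?A \<in> sets (\<mu> \<Otimes>\<^sub>M \<mu>)"
  proof -
    have "{p \<in> space (\<mu> \<Otimes>\<^sub>M \<mu>). dist (fst p) (snd p) \<le> r} \<in> sets (\<mu> \<Otimes>\<^sub>M \<mu>)" by measurable
    then show ?thesis by simp
  qed
  have "measure \<mu> (cball x r) = (LINT y|\<mu>. indicator ?A (x, y))" for x
  proof -
    have "(\<lambda>y. indicator ?A (x, y) :: real) = indicator (cball x r)"
      by (auto simp: indicator_def fun_eq_iff)
    then show ?thesis by (simp add: sets_eq_borel)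
  qed
  then have "correlation_integral \<mu> r = (LINT x|\<mu>. LINT y|\<mu>. indicator ?A (x, y))"
    by (simp add: correlation_integral_def)
  also have "\<dots> = (LINT p|(\<mu> \<Otimes>\<^sub>M \<mu>). indicator ?A p)"
    by (rule pair.integral_fst', rule pair.integrable_const_bound[where B=1]) simp_all
  finally show ?thesis by simp
qed

text \<open>
  Countably many balls of radius \<open>r / 2\<close> cover the space, so one of them, \<open>B\<close>, has positive measure.
  Any two points of \<open>B\<close> are at distance at most \<open>r\<close>, whence \<open>\<mu>(B)\<^sup>2\<close> is a lower bound. Positivity is
  what makes the logarithm in the correlation dimension meaningful.
\<close>

lemma correlation_integral_pos:
  assumes "r > 0"
  shows "correlation_integral \<mu> r > 0"
proof -
  let ?A = "{p. dist (fst p) (snd p) \<le> r} :: ('a \<times> 'a) set"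
  obtain D :: "'a set" where D: "countable D" "\<And>X. open X \<Longrightarrow> X \<noteq> {} \<Longrightarrow> \<exists>d\<in>D. d \<in> X"
    using countable_dense_exists by metis
  have "\<exists>q\<in>D. x \<in> ball q (r/2)" for x
    using D(2)[of "ball x (r/2)"] assms by (auto simp: dist_commute)
  then have cover: "(\<Union>q\<in>D. ball q (r/2)) = space \<mu>" by auto
  have "\<exists>q\<in>D. ball q (r/2) \<notin> null_sets \<mu>"
  proof (rule ccontr)
    assume "\<not> ?thesis"
    then have "(\<Union>q\<in>D. ball q (r/2)) \<in> null_sets \<mu>"
      using D(1) by (intro null_sets_UN') auto
    then show False using cover emeasure_space_1 by (simp add: null_setsD1)
  qed
  then obtain q where "ball q (r/2) \<notin> null_sets \<mu>" by blast
  then have "0 < measure \<mu> (ball q (r/2))"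
    by (metis emeasure_eq_measure ennreal_0 measure_nonneg null_setsI open_ball borel_open sets_eq_borel less_eq_real_def)
  then have "0 < measure \<mu> (ball q (r/2)) * measure \<mu> (ball q (r/2))" by simp
  also have "\<dots> = measure (\<mu> \<Otimes>\<^sub>M \<mu>) (ball q (r/2) \<times> ball q (r/2))"
    by (simp add: measure_def emeasure_pair_measure_Times sets_eq_borel enn2real_mult)
  also have "\<dots> \<le> measure (\<mu> \<Otimes>\<^sub>M \<mu>) ?A"
  proof (rule pair.finite_measure_mono)
    show "ball q (r/2) \<times> ball q (r/2) \<subseteq> ?A"
    proof clarsimp
      fix x y assume "dist q x * 2 < r" "dist q y * 2 < r"
      then show "dist x y \<le> r" using dist_triangle3[of x y q] by simp
    qed
    have "{p \<in> space (\<mu> \<Otimes>\<^sub>M \<mu>). dist (fst p) (snd p) \<le> r} \<in> sets (\<mu> \<Otimes>\<^sub>M \<mu>)" by measurable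
    then show "?A \<in> sets (\<mu> \<Otimes>\<^sub>M \<mu>)" by simp
  qed
  finally show ?thesis by (simp add: correlation_integral_eq_measure_pair)
qed

lemma integrable_gaussian_energy:
  "integrable (\<mu> \<Otimes>\<^sub>M \<mu>) (\<lambda>p. exp (- (R * dist (fst p) (snd p))\<^sup>2 / 2))"
  by (rule pair.integrable_const_bound[where B=1]) simp_all

text \<open>
  The factor \<open>exp (1/2)\<close> here and in \<open>fourier_energy_le_gaussian_energy\<close> normalises the Gaussian to be
  at least 1 up to one standard deviation.
\<close>

lemma correlation_integral_le_gaussian_energy:
  assumes "R > 0"
  shows "correlation_integral \<mu> (1 / R) \<le> exp (1/2) * gaussian_energy \<mu> R"
proof -
  let ?A = "{p. dist (fst p) (snd p) \<le> 1 / R} :: ('a \<times> 'a) set"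
  have "{p \<in> space (\<mu> \<Otimes>\<^sub>M \<mu>). dist (fst p) (snd p) \<le> 1 / R} \<in> sets (\<mu> \<Otimes>\<^sub>M \<mu>)" by measurable
  then have [measurable]: "?A \<in> sets (\<mu> \<Otimes>\<^sub>M \<mu>)" by simp
  have "correlation_integral \<mu> (1 / R) = (LINT p|(\<mu> \<Otimes>\<^sub>M \<mu>). indicator ?A p)"
    by (simp add: correlation_integral_eq_measure_pair)
  also have "\<dots> \<le> (LINT p|(\<mu> \<Otimes>\<^sub>M \<mu>). exp (1/2) * exp (- (R * dist (fst p) (snd p))\<^sup>2 / 2))"
  proof (rule integral_mono)
    fix p :: "'a \<times> 'a"
    show "indicator ?A p \<le> exp (1/2) * exp (- (R * dist (fst p) (snd p))\<^sup>2 / 2)"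
    proof (cases "p \<in> ?A")
      case True
      then have "R * dist (fst p) (snd p) \<le> 1" using assms by (simp add: field_simps)
      then have "(R * dist (fst p) (snd p))\<^sup>2 \<le> 1" using assms by (simp add: power_le_one)
      then show ?thesis using True by (simp add: exp_add[symmetric])
    qed simp
  qed (use integrable_gaussian_energy in \<open>simp_all add: pair.integrable_const_bound[where B=1]\<close>)
  finally show ?thesis by (simp add: gaussian_energy_def)
qed

text \<open>
  The Gaussian is at most 1 within \<open>t\<close> standard deviations and at most \<open>exp (- t\<^sup>2 / 2)\<close> beyond.
\<close>

lemma gaussian_energy_le_correlation_integral:
  assumes "R > 0" "t \<ge> 0"
  shows "gaussian_energy \<mu> R \<le> correlation_integral \<mu> (t / R) + exp (- t\<^sup>2 / 2)"
proof -
  let ?A = "{p. dist (fst p) (snd p) \<le> t / R} :: ('a \<times> 'a) set"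
  have "{p \<in> space (\<mu> \<Otimes>\<^sub>M \<mu>). dist (fst p) (snd p) \<le> t / R} \<in> sets (\<mu> \<Otimes>\<^sub>M \<mu>)" by measurable
  then have [measurable]: "?A \<in> sets (\<mu> \<Otimes>\<^sub>M \<mu>)" by simp
  have [simp]: "integrable (\<mu> \<Otimes>\<^sub>M \<mu>) (indicator ?A :: _ \<Rightarrow> real)"
    by (rule pair.integrable_const_bound[where B=1]) simp_all
  have "gaussian_energy \<mu> R \<le> (LINT p|(\<mu> \<Otimes>\<^sub>M \<mu>). indicator ?A p + exp (- t\<^sup>2 / 2))"
    unfolding gaussian_energy_def
  proof (rule integral_mono)
    fix p :: "'a \<times> 'a"
    show "exp (- (R * dist (fst p) (snd p))\<^sup>2 / 2) \<le> indicator ?A p + exp (- t\<^sup>2 / 2)"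
    proof (cases "p \<in> ?A")
      case True
      then show ?thesis by (simp add: add_increasing2)
    next
      case False
      then have "t \<le> R * dist (fst p) (snd p)" using assms by (simp add: field_simps)
      then have "t\<^sup>2 \<le> (R * dist (fst p) (snd p))\<^sup>2" using assms by (intro power_mono) auto
      then show ?thesis using False by simp
    qed
  qed (use integrable_gaussian_energy in simp_all)
  also have "\<dots> = correlation_integral \<mu> (t / R) + exp (- t\<^sup>2 / 2)"
    by (simp add: correlation_integral_eq_measure_pair pair.prob_space[simplified])
  finally show ?thesis .
qed

lemma integrable_fourier_energy:
  "integrable lborel (\<lambda>z. indicator (cball 0 R) z * (cmod (fourier_transform \<mu> z))\<^sup>2)"
proof (rule Bochner_Integration.integrable_bound)
  show "integrable lborel (indicator (cball (0::'a) R) :: _ \<Rightarrow> real)"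
    by (rule integrable_real_indicator) (use emeasure_lborel_cball_finite in \<open>auto simp: less_top\<close>)
  have [measurable]: "cball (0::'a) R \<in> sets borel" by simp
  show "(\<lambda>z. indicator (cball 0 R) z * (cmod (fourier_transform \<mu> z))\<^sup>2) \<in> borel_measurable lborel"
    by measurable
qed (auto simp: norm_fourier_transform_sq_le_1 indicator_def)

lemma fourier_energy_le_gaussian_energy:
  assumes "R > 0"
  shows "fourier_energy \<mu> R \<le> exp (1/2) * (sqrt (2 * pi) * R) ^ DIM('a) * gaussian_energy \<mu> R"
proof -
  have "fourier_energy \<mu> R = (LINT z|lborel. indicator (cball 0 R) z * (cmod (fourier_transform \<mu> z))\<^sup>2)"
    by (simp add: fourier_energy_def set_lebesgue_integral_def)
  also have "\<dots> \<le> (LINT z|lborel. exp (1/2) * (exp (- (norm z)\<^sup>2 / (2 * R\<^sup>2)) * (cmod (fourier_transform \<mu> z))\<^sup>2))"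
  proof (rule integral_mono)
    fix z :: 'a
    have "indicator (cball 0 R) z \<le> exp (1/2) * exp (- (norm z)\<^sup>2 / (2 * R\<^sup>2))"
    proof (cases "z \<in> cball 0 R")
      case True
      then have "(norm z)\<^sup>2 \<le> R\<^sup>2" by (simp add: power_mono)
      then have "(norm z)\<^sup>2 / (2 * R\<^sup>2) \<le> 1 / 2" using assms by (simp add: field_simps)
      then show ?thesis using True by (simp add: exp_add[symmetric])
    qed simp
    then show "indicator (cball 0 R) z * (cmod (fourier_transform \<mu> z))\<^sup>2
      \<le> exp (1/2) * (exp (- (norm z)\<^sup>2 / (2 * R\<^sup>2)) * (cmod (fourier_transform \<mu> z))\<^sup>2)"
      unfolding mult.assoc[symmetric] by (intro mult_right_mono) auto
  qed (use integrable_fourier_energy integrable_gaussian_fourier_transform[OF assms] in auto)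
  also have "\<dots> = exp (1/2) * (sqrt (2 * pi) * R) ^ DIM('a) * gaussian_energy \<mu> R"
    using gaussian_parseval[OF assms] by simp
  finally show ?thesis .
qed

text \<open>
  Outside the ball of radius \<open>t * R\<close> one half of the exponent yields the small factor
  \<open>exp (- t\<^sup>2 / 4)\<close>. The other half remains as a Gaussian of width \<open>sqrt 2 * R\<close>, which keeps the
  tail integrable over the whole space.
\<close>

lemma gaussian_energy_le_fourier_energy:
  assumes "R > 0" "t \<ge> 0"
  shows "(sqrt (2 * pi) * R) ^ DIM('a) * gaussian_energy \<mu> R \<le>
    fourier_energy \<mu> (t * R) + exp (- t\<^sup>2 / 4) * (sqrt (2 * pi) * (sqrt 2 * R)) ^ DIM('a)"
proof -
  have R': "sqrt 2 * R > 0" using assms by simp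
  let ?F = "\<lambda>z. (cmod (fourier_transform \<mu> z))\<^sup>2"
  let ?g = "\<lambda>z::'a. exp (- (norm z)\<^sup>2 / (2 * (sqrt 2 * R)\<^sup>2))"
  have g: "integrable lborel ?g" "integral\<^sup>L lborel ?g = (sqrt (2 * pi) * (sqrt 2 * R)) ^ DIM('a)"
    using gaussian_integral[OF R', where 'a='a] by (simp_all only: has_bochner_integral_iff)
  have "(sqrt (2 * pi) * R) ^ DIM('a) * gaussian_energy \<mu> R = (LINT z|lborel. exp (- (norm z)\<^sup>2 / (2 * R\<^sup>2)) * ?F z)"
    using gaussian_parseval[OF assms(1)] by simp
  also have "\<dots> \<le> (LINT z|lborel. indicator (cball 0 (t * R)) z * ?F z + exp (- t\<^sup>2 / 4) * ?g z)"
  proof (rule integral_mono)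
    fix z :: 'a
    show "exp (- (norm z)\<^sup>2 / (2 * R\<^sup>2)) * ?F z \<le> indicator (cball 0 (t * R)) z * ?F z + exp (- t\<^sup>2 / 4) * ?g z"
    proof (cases "z \<in> cball 0 (t * R)")
      case True
      then show ?thesis by (simp add: add_increasing2 mult_le_cancel_right2)
    next
      case False
      then have "(t * R)\<^sup>2 \<le> (norm z)\<^sup>2" using assms by (intro power_mono) auto
      then have "t\<^sup>2 / 4 \<le> (norm z)\<^sup>2 / (4 * R\<^sup>2)"
        using assms by (simp add: field_simps power_mult_distrib)
      then have le: "exp (- (norm z)\<^sup>2 / (2 * R\<^sup>2)) \<le> exp (- t\<^sup>2 / 4) * ?g z"
        by (simp add: exp_add[symmetric] power_mult_distrib)
      have "exp (- (norm z)\<^sup>2 / (2 * R\<^sup>2)) * ?F z \<le> exp (- (norm z)\<^sup>2 / (2 * R\<^sup>2))"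
        by (simp add: norm_fourier_transform_sq_le_1 mult_le_cancel_left1)
      also note le
      finally show ?thesis using False by simp
    qed
  qed (use g integrable_fourier_energy integrable_gaussian_fourier_transform[OF assms(1)] in auto)
  also have "\<dots> = fourier_energy \<mu> (t * R) + exp (- t\<^sup>2 / 4) * (sqrt (2 * pi) * (sqrt 2 * R)) ^ DIM('a)"
    using g integrable_fourier_energy
    by (subst Bochner_Integration.integral_add) (simp_all add: fourier_energy_def set_lebesgue_integral_def)
  finally show ?thesis .
qed

end

section \<open>Comparison of growth exponents\<close>

text \<open>
  This absorbs both the multiplicative constant \<open>K\<close> and the Gaussian tail at \<open>t = R powr \<delta>\<close> into an
  arbitrarily small power loss \<open>R powr - \<eta>\<close>.
\<close>

lemma gaussian_tail_negligible:
  fixes K L p k \<delta> \<eta> :: real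
  assumes "K > 0" "k > 0" "\<delta> > 0" "\<eta> > 0"
  shows "\<forall>\<^sub>F R in at_top. R powr - \<eta> \<le> K - L * R powr p * exp (- k * (R powr \<delta>)\<^sup>2)"
proof -
  have "((\<lambda>R. R powr p * exp (- k * (R powr \<delta>)\<^sup>2)) \<longlongrightarrow> 0) at_top"
    using assms by real_asymp
  from tendsto_mult_right_zero[OF this, of L]
  have tail: "((\<lambda>R. L * R powr p * exp (- k * (R powr \<delta>)\<^sup>2)) \<longlongrightarrow> 0) at_top"
    by (simp add: mult.assoc)
  have "((\<lambda>R. R powr - \<eta>) \<longlongrightarrow> 0) at_top"
    using assms by real_asymp
  from tendsto_diff[OF tendsto_diff[OF tendsto_const[of K] tail] this]
  have "((\<lambda>R. K - L * R powr p * exp (- k * (R powr \<delta>)\<^sup>2) - R powr - \<eta>) \<longlongrightarrow> K) at_top"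
    by simp
  then have "\<forall>\<^sub>F R in at_top. 0 < K - L * R powr p * exp (- k * (R powr \<delta>)\<^sup>2) - R powr - \<eta>"
    using assms(1) order_tendstoD(1) by blast
  then show ?thesis by eventually_elim simp
qed

context borel_prob_space
begin

text \<open>
  For \<open>0 < r < 1\<close> the denominator \<open>ln r\<close> is negative, so lower bounds on the correlation integral
  become upper bounds on the dimension, and conversely in the lemma that follows.
\<close>

lemma upper_correlation_dim_le:
  assumes "\<forall>\<^sub>F r in at_right 0. r powr a \<le> correlation_integral \<mu> r"
  shows "upper_correlation_dim \<mu> \<le> ereal a"
  unfolding upper_correlation_dim_def correlation_integral_def[symmetric]
proof (rule Limsup_bounded)
  have "\<forall>\<^sub>F r in at_right 0. r \<in> {0<..<(1::real)}"
    by (rule eventually_at_right_real) simp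
  with assms show "\<forall>\<^sub>F r in at_right 0. ereal (ln (correlation_integral \<mu> r) / ln r) \<le> ereal a"
  proof eventually_elim
    case (elim r)
    then have "ln (r powr a) \<le> ln (correlation_integral \<mu> r)"
      using correlation_integral_pos[of r] by (subst ln_le_cancel_iff) auto
    then show ?case using elim by (simp add: ln_powr divide_le_eq)
  qed
qed

lemma powr_le_correlation_integral:
  assumes "upper_correlation_dim \<mu> < ereal a"
  shows "\<forall>\<^sub>F r in at_right 0. r powr a \<le> correlation_integral \<mu> r"
proof -
  have "\<forall>\<^sub>F r in at_right 0. ereal (ln (correlation_integral \<mu> r) / ln r) < ereal a"
    using assms unfolding upper_correlation_dim_def correlation_integral_def[symmetric]
    by (rule Limsup_lessD)
  moreover have "\<forall>\<^sub>F r in at_right 0. r \<in> {0<..<(1::real)}"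
    by (rule eventually_at_right_real) simp
  ultimately show ?thesis
  proof eventually_elim
    case (elim r)
    then have "ln (r powr a) \<le> ln (correlation_integral \<mu> r)"
      by (simp add: ln_powr divide_less_eq split: if_splits)
    then show ?case
      using elim correlation_integral_pos[of r] by (subst (asm) ln_le_cancel_iff) auto
  qed
qed

text \<open>
  Passing from the energy at \<open>R\<close> to the Gaussian energy at \<open>R\<close> and then to the correlation integral
  at \<open>r = R powr (\<delta> - 1)\<close> gives the lower bound \<open>R powr (- s - \<delta>)\<close>.
\<close>

lemma upper_correlation_dim_le_of_fourier_energy:
  assumes "s \<ge> 0" and energy: "\<forall>\<^sub>F R in at_top. R powr (real DIM('a) - s) \<le> fourier_energy \<mu> R"
  shows "upper_correlation_dim \<mu> \<le> ereal s"
proof (rule ereal_le_epsilon2)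
  fix \<epsilon> :: real assume "\<epsilon> > 0"
  \<comment> \<open>This \<open>\<delta>\<close> makes \<open>R powr (- s - \<delta>)\<close> equal to \<open>r powr (s + \<epsilon>)\<close> for \<open>r = R powr (\<delta> - 1)\<close>.\<close>
  define \<delta> where "\<delta> = \<epsilon> / (1 + s + \<epsilon>)"
  have \<delta>: "\<delta> > 0" "\<delta> < 1" "s + \<delta> = (1 - \<delta>) * (s + \<epsilon>)"
    using \<open>\<epsilon> > 0\<close> assms(1) by (simp_all add: \<delta>_def field_simps)
  define K where "K = exp (1/2) * sqrt (2 * pi) ^ DIM('a)"
  have "K > 0" by (simp add: K_def)
  have "\<forall>\<^sub>F R in at_top. R powr - \<delta> \<le> 1 / K - 1 * R powr s * exp (- (1/2) * (R powr \<delta>)\<^sup>2)"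
    using \<open>K > 0\<close> \<delta> by (intro gaussian_tail_negligible) auto
  with energy eventually_gt_at_top[of "0::real"]
  have *: "\<forall>\<^sub>F R in at_top. (R powr (\<delta> - 1)) powr (s + \<epsilon>) \<le> correlation_integral \<mu> (R powr (\<delta> - 1))"
  proof eventually_elim
    case (elim R)
    have "R powr (real DIM('a) - s) \<le> K * R ^ DIM('a) * gaussian_energy \<mu> R"
      using elim fourier_energy_le_gaussian_energy[of R] by (simp add: K_def power_mult_distrib mult_ac)
    also have "\<dots> \<le> K * R ^ DIM('a) * (correlation_integral \<mu> (R powr \<delta> / R) + exp (- (R powr \<delta>)\<^sup>2 / 2))"
      using elim \<open>K > 0\<close> by (intro mult_left_mono gaussian_energy_le_correlation_integral) auto
    finally have "R ^ DIM('a) * R powr - s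
        \<le> R ^ DIM('a) * (K * (correlation_integral \<mu> (R powr \<delta> / R) + exp (- (R powr \<delta>)\<^sup>2 / 2)))"
      using elim by (simp add: powr_diff powr_realpow powr_minus_divide mult_ac)
    then have "R powr - s \<le> K * (correlation_integral \<mu> (R powr \<delta> / R) + exp (- (R powr \<delta>)\<^sup>2 / 2))"
      using elim by (subst (asm) mult_le_cancel_left_pos) auto
    then have "R powr - s / K \<le> correlation_integral \<mu> (R powr \<delta> / R) + exp (- (R powr \<delta>)\<^sup>2 / 2)"
      using \<open>K > 0\<close> by (simp add: pos_divide_le_eq mult.commute)
    moreover have "R powr - s * R powr - \<delta> \<le> R powr - s * (1 / K - 1 * R powr s * exp (- (1/2) * (R powr \<delta>)\<^sup>2))"
      using elim by (intro mult_left_mono) auto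
    moreover have "R powr - s * (1 / K - 1 * R powr s * exp (- (1/2) * (R powr \<delta>)\<^sup>2)) = R powr - s / K - exp (- (R powr \<delta>)\<^sup>2 / 2)"
      using elim by (simp add: powr_minus field_simps)
    ultimately have "R powr - s * R powr - \<delta> \<le> correlation_integral \<mu> (R powr \<delta> / R)"
      by linarith
    moreover have "R powr - s * R powr - \<delta> = (R powr (\<delta> - 1)) powr (s + \<epsilon>)"
    proof -
      have "(\<delta> - 1) * (s + \<epsilon>) = - s + - \<delta>" using \<delta>(3) by algebra
      then show ?thesis by (simp only: powr_powr powr_add[symmetric])
    qed
    ultimately show ?case using elim by (simp add: powr_diff)
  qed
  have "filterlim (\<lambda>r::real. r powr (- 1 / (1 - \<delta>))) at_top (at_right 0)"
    using \<delta> by real_asymp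
  from eventually_compose_filterlim[OF * this] eventually_at_right_less[of "0::real"]
  have "\<forall>\<^sub>F r in at_right 0. r powr (s + \<epsilon>) \<le> correlation_integral \<mu> r"
  proof eventually_elim
    case (elim r)
    moreover have "(- 1 / (1 - \<delta>)) * (\<delta> - 1) = 1" using \<delta> by (simp add: field_simps)
    ultimately show ?case by (simp only: powr_powr) simp
  qed
  then show "upper_correlation_dim \<mu> \<le> ereal s + ereal \<epsilon>"
    using upper_correlation_dim_le by simp
qed

text \<open>
  For some \<open>a < s\<close>, the correlation integral at \<open>1 / R\<close> is eventually at least \<open>R powr - a\<close>. Via the
  Gaussian energy at \<open>R\<close> this becomes a lower bound of order \<open>R powr (d - a)\<close> for the Fourier energy
  at \<open>R powr (1 + \<delta>)\<close>. The gap between \<open>a\<close> and \<open>s\<close> pays for the factor \<open>1 + \<delta>\<close> in the exponent.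
\<close>

lemma fourier_energy_ge_of_upper_correlation_dim:
  assumes "s \<ge> 0" "upper_correlation_dim \<mu> < ereal s"
  shows "\<forall>\<^sub>F R in at_top. R powr (real DIM('a) - s) \<le> fourier_energy \<mu> R"
proof -
  obtain a where a: "upper_correlation_dim \<mu> < ereal a" "a < s"
    using ereal_dense2[OF assms(2)] by auto
  define \<delta> where "\<delta> = (s - a) / (real DIM('a) + 1)"
  have \<delta>: "\<delta> > 0" "\<delta> * (real DIM('a) + 1) = s - a" using a by (simp_all add: \<delta>_def)
  \<comment> \<open>The room between the available exponent \<open>d - a\<close> and the required one \<open>(1 + \<delta>) (d - s)\<close>;
    the denominator of \<open>\<delta>\<close> is chosen to make it positive.\<close>
  define \<eta> where "\<eta> = (real DIM('a) - a) - (1 + \<delta>) * (real DIM('a) - s)"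
  have \<eta>: "\<eta> > 0"
  proof -
    have "\<eta> = \<delta> + \<delta> * s" using \<delta>(2) by (simp add: \<eta>_def algebra_simps)
    then show ?thesis using \<delta>(1) assms(1) by (simp add: add_pos_nonneg)
  qed
  define c where "c = sqrt (2 * pi) ^ DIM('a)"
  have "c > 0" by (simp add: c_def)
  have "filterlim (\<lambda>R::real. 1 / R) (at_right 0) at_top" by real_asymp
  from eventually_compose_filterlim[OF powr_le_correlation_integral[OF a(1)] this]
  have "\<forall>\<^sub>F R in at_top. (1 / R) powr a \<le> correlation_integral \<mu> (1 / R)" .
  moreover have "\<forall>\<^sub>F R in at_top. R powr - \<eta> \<le> c * exp (- 1 / 2) - c * sqrt 2 ^ DIM('a) * R powr a * exp (- (1/4) * (R powr \<delta>)\<^sup>2)"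
    using \<open>c > 0\<close> \<delta> \<eta> by (intro gaussian_tail_negligible) auto
  ultimately have *: "\<forall>\<^sub>F R in at_top. (R powr (1 + \<delta>)) powr (real DIM('a) - s) \<le> fourier_energy \<mu> (R powr (1 + \<delta>))"
    using eventually_gt_at_top[of "0::real"]
  proof eventually_elim
    case (elim R)
    let ?d = "DIM('a)"
    have "(1 / R) powr a \<le> exp (1/2) * gaussian_energy \<mu> R"
      using elim correlation_integral_le_gaussian_energy[of R] by simp
    then have "exp (- 1 / 2) * (1 / R) powr a \<le> exp (- 1 / 2) * (exp (1/2) * gaussian_energy \<mu> R)"
      by (intro mult_left_mono) auto
    then have "exp (- 1 / 2) * (1 / R) powr a \<le> gaussian_energy \<mu> R"
      by (simp add: mult.assoc[symmetric] exp_add[symmetric])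
    then have "c * R ^ ?d * (exp (- 1 / 2) * (1 / R) powr a) \<le> c * R ^ ?d * gaussian_energy \<mu> R"
      using elim \<open>c > 0\<close> by (intro mult_left_mono) auto
    also have "\<dots> \<le> fourier_energy \<mu> (R powr \<delta> * R) + exp (- (R powr \<delta>)\<^sup>2 / 4) * (c * sqrt 2 ^ ?d * R ^ ?d)"
      using elim gaussian_energy_le_fourier_energy[of R "R powr \<delta>"]
      by (simp add: c_def power_mult_distrib mult_ac)
    finally have "c * R ^ ?d * (exp (- 1 / 2) * (1 / R) powr a) - exp (- (R powr \<delta>)\<^sup>2 / 4) * (c * sqrt 2 ^ ?d * R ^ ?d)
        \<le> fourier_energy \<mu> (R powr \<delta> * R)" by simp
    also have "c * R ^ ?d * (exp (- 1 / 2) * (1 / R) powr a) - exp (- (R powr \<delta>)\<^sup>2 / 4) * (c * sqrt 2 ^ ?d * R ^ ?d)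
      = R powr (real ?d - a) * (c * exp (- 1 / 2) - c * sqrt 2 ^ ?d * R powr a * exp (- (1/4) * (R powr \<delta>)\<^sup>2))"
      using elim by (simp add: powr_diff powr_realpow powr_divide field_simps)
    finally have "R powr (real ?d - a) * (c * exp (- 1 / 2) - c * sqrt 2 ^ ?d * R powr a * exp (- (1/4) * (R powr \<delta>)\<^sup>2))
      \<le> fourier_energy \<mu> (R powr (1 + \<delta>))"
      using elim by (simp add: powr_add mult.commute)
    moreover have "R powr (real ?d - a) * R powr - \<eta> \<le>
        R powr (real ?d - a) * (c * exp (- 1 / 2) - c * sqrt 2 ^ ?d * R powr a * exp (- (1/4) * (R powr \<delta>)\<^sup>2))"
      using elim by (intro mult_left_mono) auto
    moreover have "R powr (real ?d - a) * R powr - \<eta> = (R powr (1 + \<delta>)) powr (real ?d - s)"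
      by (simp add: powr_powr powr_add[symmetric] \<eta>_def)
    ultimately show ?case by linarith
  qed
  have "filterlim (\<lambda>R::real. R powr (1 / (1 + \<delta>))) at_top at_top"
    using \<delta>(1) by real_asymp
  from eventually_compose_filterlim[OF * this] eventually_gt_at_top[of "0::real"]
  show ?thesis
  proof eventually_elim
    case (elim R)
    moreover have "1 / (1 + \<delta>) * (1 + \<delta>) = 1" using \<delta> by simp
    ultimately show ?case by (simp only: powr_powr) simp
  qed
qed

end

section \<open>The dimension of a set\<close>

lemma borel_probs_on_iff:
  "\<mu> \<in> borel_probs_on E \<longleftrightarrow> borel_prob_space \<mu> \<and> emeasure \<mu> (UNIV - E) = 0"
  by (auto simp: borel_probs_on_def borel_prob_space_def borel_prob_space_axioms_def)

text \<open>
  A point mass has constant correlation integral 1, hence dimension 0.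
\<close>

lemma upper_correlation_dim_set_nonneg:
  assumes "E \<in> sets borel" "E \<noteq> {}"
  shows "0 \<le> upper_correlation_dim_set E"
proof -
  obtain x where "x \<in> E" using assms(2) by blast
  let ?\<mu> = "return borel x"
  have "?\<mu> \<in> borel_probs_on E"
    using assms(1) \<open>x \<in> E\<close> by (auto simp: borel_probs_on_def prob_space_return emeasure_return)
  moreover have "upper_correlation_dim ?\<mu> = 0"
  proof -
    have "upper_correlation_dim ?\<mu> = Limsup (at_right 0) (\<lambda>r::real. 0)"
      unfolding upper_correlation_dim_def
    proof (rule Limsup_eq)
      show "\<forall>\<^sub>F r in at_right 0. ereal (ln (LINT y|?\<mu>. measure ?\<mu> (cball y r)) / ln r) = 0"
        using eventually_at_right_less[of "0::real"]
      proof eventually_elim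
        case (elim r)
        have "measure ?\<mu> (cball y r) = indicator (cball x r) y" for y
          by (simp add: measure_return indicator_def dist_commute)
        then have "(LINT y|?\<mu>. measure ?\<mu> (cball y r)) = (LINT y|?\<mu>. indicator (cball x r) y)"
          by simp
        also have "\<dots> = indicator (cball x r) x"
          by (rule integral_return) (simp_all add: borel_measurable_indicator)
        also have "\<dots> = (1::real)" using elim by simp
        finally show ?case by (simp add: zero_ereal_def)
      qed
    qed
    then show ?thesis by (simp add: Limsup_const)
  qed
  ultimately show ?thesis
    unfolding upper_correlation_dim_set_def by (metis SUP_upper)
qed

theorem corollary4p5:
  fixes E :: "'a::euclidean_space set"
  assumes "E \<in> sets borel" and "bounded E" and "E \<noteq> {}"
  shows "upper_correlation_dim_set E =
    Inf (ereal ` {s::real. s \<ge> 0 \<and>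
      (\<forall>\<mu>\<in>borel_probs_on E. \<forall>\<^sub>F R in at_top.
         (LINT z:cball 0 R|lborel. (cmod (fourier_transform \<mu> z))\<^sup>2)
           \<ge> R powr (real DIM('a) - s))})"
  unfolding fourier_energy_def[symmetric]
proof (rule antisym)
  let ?S = "{s::real. s \<ge> 0 \<and>
    (\<forall>\<mu>\<in>borel_probs_on E. \<forall>\<^sub>F R in at_top. R powr (real DIM('a) - s) \<le> fourier_energy \<mu> R)}"
  show "upper_correlation_dim_set E \<le> Inf (ereal ` ?S)"
    unfolding upper_correlation_dim_set_def
    by (intro INF_greatest SUP_least)
       (auto simp: borel_probs_on_iff intro: borel_prob_space.upper_correlation_dim_le_of_fourier_energy)
  show "Inf (ereal ` ?S) \<le> upper_correlation_dim_set E"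
  \<comment> \<open>Every real number strictly above the dimension of the set belongs to the set on the right-hand side.\<close>
  proof (rule dense_ge)
    fix y assume "upper_correlation_dim_set E < y"
    then obtain s where s: "upper_correlation_dim_set E < ereal s" "ereal s < y"
      using ereal_dense2 by blast
    have "s \<ge> 0"
      using upper_correlation_dim_set_nonneg[OF assms(1,3)] s(1) by (cases "upper_correlation_dim_set E") auto
    moreover have "\<forall>\<^sub>F R in at_top. R powr (real DIM('a) - s) \<le> fourier_energy \<mu> R"
      if "\<mu> \<in> borel_probs_on E" for \<mu>
    proof -
      have "upper_correlation_dim \<mu> < ereal s"
        using s(1) that unfolding upper_correlation_dim_set_def by (meson SUP_upper le_less_trans)
      with \<open>s \<ge> 0\<close> that show ?thesis
        by (auto simp: borel_probs_on_iff intro: borel_prob_space.fourier_energy_ge_of_upper_correlation_dim)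
    qed
    ultimately have "Inf (ereal ` ?S) \<le> ereal s" by (intro INF_lower) auto
    with s(2) show "Inf (ereal ` ?S) \<le> y" by simp
  qed
qed

end
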